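(* A hypergraph $\mathcal H$ is $\iota$-acyclic if and only if it has no Berge cycle of length strictly greater than two.
   Context: A (multi-)hypergraph $\mathcal H=(\mathcal V,\mathcal E)$ has a finite set $\mathcal V$ of vertices and a finite multiset $\mathcal E$ of non-empty subsets of $\mathcal V$ (hyperedges), labelled so that equal hyperedges are distinguishable (and count as distinct hyperedges). $\mathcal E_u$ is the set of (labelled) hyperedges containing $u$. The transformation $\tau$. For each vertex $u\in\mathcal V$ let $n_u=|\mathcal E_u|$ and introduce fresh vertices $\tilde u_1,\dots,\tilde u_{n_u}$. For each choice of one permutation $\sigma^u=(\sigma^u_1,\dots,\sigma^u_{n_u})$ of $\mathcal E_u$ for every $u\in\mathcal V$, let $\tilde{\mathcal H}$ be the hypergraph with vertices $\bigcup_u\{\tilde u_1,\dots,\tilde u_{n_u}\}$ and one hyperedge $\tilde e=\bigcup_{u\in e}\{\tilde u_1,\dots,\tilde u_{p_u(e)}\}$ for each $e\in\mathcal E$, where $p_u(e)$ is the position of $e$ in $\sigma^u$. Then $\tau(\mathcal H)$ is the set of all hypergraphs $\tilde{\mathcal H}$ so obtained. $\alpha$-acyclicity. A hypergraph is $\alpha$-acyclic iff it has a join tree: a tree $\mathcal T$ with a bijection $\chi$ from its nodes to the (labelled) hyperedges such that for every vertex $v$ the set $\{t: v\in\chi(t)\}$ is a connected subtree. Equivalently, its set of hyperedges can be reduced to the empty set by repeatedly removing a vertex that occurs in only one hyperedge, or removing a hyperedge contained in another hyperedge (GYO reduction). $\mathcal H$ is $\iota$-acyclic iff every hypergraph in $\tau(\mathcal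 H)$ is $\alpha$-acyclic. A Berge cycle of length $n$ in $\mathcal H$ is a sequence $(e^1,v^1,e^2,v^2,\dots,e^n,v^n,e^{n+1})$ such that $v^1,\dots,v^n$ are distinct vertices, $e^1,\dots,e^n$ are distinct hyperedges, $e^{n+1}=e^1$, $n\ge2$, and $v^i\in e^i\cap e^{i+1}$ for each $1\le i\le n$. *)

theory Defs
  imports Main
begin

text \<open>
  A multi-hypergraph: the hyperedges are represented by labels, and \<^term>\<open>ends H e\<close> is the set of
  vertices of the hyperedge labelled \<open>e\<close>. Distinct labels may carry equal vertex sets.
  The value of \<open>ends H\<close> outside \<open>edges H\<close> is irrelevant.
\<close>

record ('v, 'e) hypergraph =
  verts :: "'v set"
  edges :: "'e set"
  ends :: "'e \<Rightarrow> 'v set"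

locale hypergraph =
  fixes H :: "('v, 'e) hypergraph"
  assumes finite_verts: "finite (verts H)"
    and finite_edges: "finite (edges H)"
    and ends_nonempty: "e \<in> edges H \<Longrightarrow> ends H e \<noteq> {}"
    and ends_subset: "e \<in> edges H \<Longrightarrow> ends H e \<subseteq> verts H"

definition edges_at :: "('v, 'e) hypergraph \<Rightarrow> 'v \<Rightarrow> 'e set" where
  "edges_at H u = {e \<in> edges H. u \<in> ends H e}"

text \<open>
  A choice of one permutation of \<^term>\<open>edges_at H u\<close> for every vertex \<open>u\<close>; the entry at
  position \<open>i\<close> of the permutation for \<open>u\<close> is \<open>\<sigma> u i\<close>, positions being counted from 1.
\<close>

definition edge_orderings :: "('v, 'e) hypergraph \<Rightarrow> ('v \<Rightarrow> nat \<Rightarrow> 'e) set" where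
  "edge_orderings H =
    {\<sigma>. \<forall>u\<in>verts H. bij_betw (\<sigma> u) {1..card (edges_at H u)} (edges_at H u)}"

definition edge_position ::
    "('v, 'e) hypergraph \<Rightarrow> ('v \<Rightarrow> nat \<Rightarrow> 'e) \<Rightarrow> 'v \<Rightarrow> 'e \<Rightarrow> nat" where
  "edge_position H \<sigma> u e = inv_into {1..card (edges_at H u)} (\<sigma> u) e"

text \<open>The pair \<open>(u, i)\<close> is the \<open>i\<close>-th fresh copy of the vertex \<open>u\<close>.\<close>

definition expand :: "('v, 'e) hypergraph \<Rightarrow> ('v \<Rightarrow> nat \<Rightarrow> 'e) \<Rightarrow> ('v \<times> nat, 'e) hypergraph" where
  "expand H \<sigma> =
    \<lparr>verts = (\<Union>u\<in>verts H. {u} \<times> {1..card (edges_at H u)}),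
     edges = edges H,
     ends = (\<lambda>e. \<Union>u\<in>ends H e. {u} \<times> {1..edge_position H \<sigma> u e})\<rparr>"

definition tau :: "('v, 'e) hypergraph \<Rightarrow> ('v \<times> nat, 'e) hypergraph set" where
  "tau H = expand H ` edge_orderings H"

definition connected_in :: "'n set set \<Rightarrow> 'n set \<Rightarrow> bool" where
  "connected_in T S \<longleftrightarrow>
    (\<forall>s\<in>S. \<forall>t\<in>S. (s, t) \<in> {(x, y). x \<in> S \<and> y \<in> S \<and> {x, y} \<in> T}\<^sup>*)"

definition graph_cycle :: "'n set set \<Rightarrow> 'n list \<Rightarrow> bool" where
  "graph_cycle T xs \<longleftrightarrow>
    3 \<le> length xs \<and> distinct xs \<and>
    (\<forall>i<length xs. {xs ! i, xs ! (Suc i mod length xs)} \<in> T)"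

text \<open>
  Finite trees with node set \<open>N\<close> and edge set \<open>T\<close>. The empty tree is admitted, so that a
  hypergraph without hyperedges has a join tree (it is \<open>\<alpha>\<close>-acyclic by GYO reduction).
  The trees of the AFP entry Graph Theory are not suitable here: they are digraphs without directed
  cycles, which excludes symmetric digraphs with an arc and admits acyclic orientations of undirected cycles.
\<close>

definition is_tree :: "'n set \<Rightarrow> 'n set set \<Rightarrow> bool" where
  "is_tree N T \<longleftrightarrow>
    finite N \<and> (\<forall>a\<in>T. a \<subseteq> N \<and> card a = 2) \<and>
    connected_in T N \<and> (\<nexists>xs. graph_cycle T xs)"

definition join_tree ::
    "('v, 'e) hypergraph \<Rightarrow> 'n set \<Rightarrow> 'n set set \<Rightarrow> ('n \<Rightarrow> 'e) \<Rightarrow> bool" where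
  "join_tree H N T \<chi> \<longleftrightarrow>
    is_tree N T \<and> bij_betw \<chi> N (edges H) \<and>
    (\<forall>v\<in>verts H. connected_in T {t \<in> N. v \<in> ends H (\<chi> t)})"

text \<open>
  Taking the nodes in the type of labels is no restriction: the nodes of a join tree are in
  bijection with \<open>edges H\<close>.
\<close>

definition alpha_acyclic :: "('v, 'e) hypergraph \<Rightarrow> bool" where
  "alpha_acyclic H \<longleftrightarrow> (\<exists>(N :: 'e set) T \<chi>. join_tree H N T \<chi>)"

definition iota_acyclic :: "('v, 'e) hypergraph \<Rightarrow> bool" where
  "iota_acyclic H \<longleftrightarrow> (\<forall>H'\<in>tau H. alpha_acyclic H')"

text \<open>
  The sequence \<open>(e\<^sup>1, v\<^sup>1, \<dots>, e\<^sup>n, v\<^sup>n, e\<^sup>n\<^sup>+\<^sup>1)\<close> is given by the list \<open>es\<close> of its \<open>n + 1\<close> hyperedges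
  and the list \<open>vs\<close> of its \<open>n\<close> vertices, both indexed from 0.
\<close>

definition berge_cycle :: "('v, 'e) hypergraph \<Rightarrow> nat \<Rightarrow> 'e list \<Rightarrow> 'v list \<Rightarrow> bool" where
  "berge_cycle H n es vs \<longleftrightarrow>
    2 \<le> n \<and> length es = n + 1 \<and> length vs = n \<and>
    set es \<subseteq> edges H \<and> set vs \<subseteq> verts H \<and>
    distinct vs \<and> distinct (take n es) \<and> es ! n = es ! 0 \<and>
    (\<forall>i<n. vs ! i \<in> ends H (es ! i) \<inter> ends H (es ! (i + 1)))"

end

theory Submission
  imports Defs
begin

text \<open>
  Given a Berge cycle of length \<open>n > 2\<close>, order the hyperedges at its \<open>i\<close>-th vertex so that the
  \<open>i\<close>-th and \<open>(i+1)\<close>-st hyperedges of the cycle come last. Then the last but one copy of that vertex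
  lies in these two hyperedges only, so they are adjacent in every join tree, which thus contains a cycle.

  Conversely, let all Berge cycles have length 2. Replacing the positions by arbitrary ranks \<open>r u e\<close>
  makes the claim stable under deleting hyperedges, so it suffices to find an ear of the expanded
  hypergraph: a hyperedge \<open>e\<close> whose intersections with all other hyperedges lie in a single other
  hyperedge \<open>f\<close>; then \<open>e\<close> is hung as a leaf on \<open>f\<close>. Take a longest Berge path
  \<open>e, v, f, u, g, \<dots>\<close>. If \<open>e\<close> shares a vertex off the path with another hyperedge, then all shared
  vertices of \<open>e\<close> and of \<open>f\<close> except \<open>u\<close> lie in \<open>e\<close> and \<open>f\<close> only, and whichever of \<open>e\<close>, \<open>f\<close> has smaller
  rank at \<open>u\<close> is an ear. Otherwise \<open>e\<close> shares exactly \<open>v\<close> and \<open>u\<close> (or at most one vertex, and is an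
  ear), every other hyperedge at \<open>v\<close> except possibly \<open>g\<close> can replace \<open>e\<close> as start of the path, and an
  ear is found by comparing ranks at \<open>v\<close> and \<open>u\<close>.
\<close>

section \<open>Elements of extreme rank in finite sets\<close>

lemma finite_has_max_image:
  fixes f :: "'a \<Rightarrow> 'b::linorder"
  assumes "finite X" "X \<noteq> {}"
  obtains x where "x \<in> X" "\<forall>y\<in>X. f y \<le> f x"
proof -
  have "Max (f ` X) \<in> f ` X" using assms by (intro Max_in) auto
  then obtain x where "x \<in> X" "f x = Max (f ` X)" by auto
  with assms that show thesis by (metis Max_ge finite_imageI imageI)
qed

lemma finite_has_min_image:
  fixes f :: "'a \<Rightarrow> 'b::linorder"
  assumes "finite X" "X \<noteq> {}"
  obtains x where "x \<in> X" "\<forall>y\<in>X. f x \<le> f y"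
proof -
  have "Min (f ` X) \<in> f ` X" using assms by (intro Min_in) auto
  then obtain x where "x \<in> X" "f x = Min (f ` X)" by auto
  with assms that show thesis by (metis Min_le finite_imageI imageI)
qed

section \<open>Connectivity, and trees with an added leaf\<close>

lemma graph_cycle_neighbours:
  assumes "graph_cycle T xs" "x \<in> set xs"
  obtains y z where "y \<noteq> z" "{x, y} \<in> T" "{x, z} \<in> T"
proof -
  let ?n = "length xs"
  from assms obtain i where i: "i < ?n" "xs ! i = x" by (auto simp: in_set_conv_nth)
  have n: "3 \<le> ?n" and d: "distinct xs"
    and E: "\<And>i. i < ?n \<Longrightarrow> {xs ! i, xs ! (Suc i mod ?n)} \<in> T"
    using assms(1) by (auto simp: graph_cycle_def)
  \<comment> \<open>\<open>j\<close> is the cyclic predecessor of \<open>i\<close> and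
    \<open>k\<close> its successor; they differ because the length is at least 3.\<close>
  define j where "j = (if i = 0 then ?n - 1 else i - 1)"
  define k where "k = Suc i mod ?n"
  have j: "j < ?n" "Suc j mod ?n = i" using i n by (auto simp: j_def)
  have k: "k < ?n" unfolding k_def using n by (intro mod_less_divisor) linarith
  have "j \<noteq> k"
    using i n by (cases "Suc i = ?n") (auto simp: j_def k_def)
  then have "xs ! j \<noteq> xs ! k" using d j k by (simp add: nth_eq_iff_index_eq)
  moreover have "{x, xs ! k} \<in> T" using E[OF i(1)] i by (simp add: k_def)
  moreover have "{x, xs ! j} \<in> T" using E[OF j(1)] i j by (simp add: insert_commute)
  ultimately show thesis using that by blast
qed

lemma connected_in_mono:
  assumes "connected_in T S" "T \<subseteq> T'"
  shows "connected_in T' S"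
proof -
  have "{(x, y). x \<in> S \<and> y \<in> S \<and> {x, y} \<in> T}\<^sup>* \<subseteq> {(x, y). x \<in> S \<and> y \<in> S \<and> {x, y} \<in> T'}\<^sup>*"
    using assms(2) by (intro rtrancl_mono) blast
  then show ?thesis using assms(1) unfolding connected_in_def by blast
qed

text \<open>All of \<open>S\<close> is linked through \<open>f\<close>, in both directions:
  \<open>e\<close> by the new edge, the rest inside \<open>S - {e}\<close>. If \<open>S\<close> has
  at most the element \<open>e\<close>, no link is required, so the demand on \<open>f\<close> is
  conditional.\<close>

lemma connected_in_insert_leaf:
  assumes conn: "connected_in T (S - {e})"
    and f: "S - {e} \<noteq> {} \<Longrightarrow> f \<in> S - {e}"
  shows "connected_in (insert {e, f} T) S"
proof -
  let ?R = "\<lambda>T S. {(x, y). x \<in> S \<and> y \<in> S \<and> {x, y} \<in> T}"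
  let ?T = "insert {e, f} T"
  have sub: "(?R T (S - {e}))\<^sup>* \<subseteq> (?R ?T S)\<^sup>*" by (rule rtrancl_mono) auto
  have to_f: "(s, f) \<in> (?R ?T S)\<^sup>* \<and> (f, s) \<in> (?R ?T S)\<^sup>*" if "s \<in> S" "S - {e} \<noteq> {}" for s
  proof (cases "s = e")
    case True
    have "(s, f) \<in> ?R ?T S" "(f, s) \<in> ?R ?T S"
      using True that f by (auto simp: insert_commute)
    then show ?thesis by blast
  next
    case False
    then have "(s, f) \<in> (?R T (S - {e}))\<^sup>*" "(f, s) \<in> (?R T (S - {e}))\<^sup>*"
      using conn f that unfolding connected_in_def by blast+
    then show ?thesis using sub by blast
  qed
  show ?thesis unfolding connected_in_def
  proof (intro ballI)
    fix s t assume st: "s \<in> S" "t \<in> S"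
    show "(s, t) \<in> (?R ?T S)\<^sup>*"
    proof (cases "S - {e} = {}")
      case True
      then have "s = t" using st by auto
      then show ?thesis by simp
    next
      case False
      then show ?thesis using to_f st by (meson rtrancl_trans)
    qed
  qed
qed

text \<open>A cycle through \<open>e\<close> would give \<open>e\<close> two distinct neighbours,
  but \<open>f\<close> is its only one; a cycle avoiding \<open>e\<close> lies in \<open>T\<close>
  already.\<close>

lemma is_tree_insert_leaf:
  assumes tree: "is_tree (N - {e}) T" and "e \<in> N" "f \<in> N" "e \<noteq> f"
  shows "is_tree N (insert {e, f} T)"
proof -
  have T: "\<And>a. a \<in> T \<Longrightarrow> a \<subseteq> N - {e} \<and> card a = 2" and "finite (N - {e})"
    and conn: "connected_in T (N - {e})" and acyc: "\<And>xs. \<not> graph_cycle T xs"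
    using tree by (auto simp: is_tree_def)
  have "\<not> graph_cycle (insert {e, f} T) xs" for xs
  proof
    assume cyc: "graph_cycle (insert {e, f} T) xs"
    have "e \<notin> set xs"
    proof
      assume "e \<in> set xs"
      with cyc obtain y z where "y \<noteq> z" "{e, y} \<in> insert {e, f} T" "{e, z} \<in> insert {e, f} T"
        by (rule graph_cycle_neighbours)
      then show False using T by (auto simp: doubleton_eq_iff dest!: T)
    qed
    have "{xs ! i, xs ! (Suc i mod length xs)} \<in> T" if "i < length xs" for i
    proof -
      have "xs ! i \<in> set xs" "xs ! (Suc i mod length xs) \<in> set xs"
        using that by (auto intro!: nth_mem mod_less_divisor)
      then have "{xs ! i, xs ! (Suc i mod length xs)} \<noteq> {e, f}"
        using \<open>e \<notin> set xs\<close> by (auto simp: doubleton_eq_iff)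
      then show ?thesis using cyc that by (auto simp: graph_cycle_def)
    qed
    then show False using acyc cyc by (auto simp: graph_cycle_def)
  qed
  moreover have "connected_in (insert {e, f} T) N"
    using conn assms by (intro connected_in_insert_leaf) auto
  ultimately show ?thesis
    using T assms \<open>finite (N - {e})\<close> by (fastforce simp: is_tree_def)
qed

section \<open>Berge paths, built from the front, where they will be extended and altered\<close>

fun berge_path :: "('v, 'e) hypergraph \<Rightarrow> 'e list \<Rightarrow> 'v list \<Rightarrow> bool" where
  "berge_path H [e] [] \<longleftrightarrow> e \<in> edges H"
| "berge_path H (e # f # es) (v # vs) \<longleftrightarrow>
    e \<in> edges H \<and> e \<notin> set (f # es) \<and> v \<notin> set vs \<and> v \<in> ends H e \<and> v \<in> ends H f \<and>
    berge_path H (f # es) vs"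
| "berge_path H _ _ \<longleftrightarrow> False"

lemma berge_path_facts:
  assumes "berge_path H es vs"
  shows "length es = Suc (length vs)" "distinct es" "distinct vs" "set es \<subseteq> edges H"
    "i < length vs \<Longrightarrow> vs ! i \<in> ends H (es ! i) \<and> vs ! i \<in> ends H (es ! Suc i)"
  using assms
proof (induction H es vs arbitrary: i rule: berge_path.induct)
  case (2 H e f es v vs)
  { case 5 then show ?case using 2 by (cases i) auto }
qed auto

context hypergraph
begin

text \<open>Chords of paths are excluded through this: as \<open>2 \<le> j\<close>, the cycle has
  length at least 3. Being its last vertex, \<open>w\<close> only has to avoid the first
  \<open>j\<close> vertices and may occur later on the path.\<close>

lemma berge_path_closing:
  assumes path: "berge_path H es vs" and j: "2 \<le> j" "j < length es"
    and w: "w \<in> ends H (es ! 0)" "w \<in> ends H (es ! j)" "w \<notin> set (take j vs)"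
  shows "berge_cycle H (Suc j) (take (Suc j) es @ [es ! 0]) (take j vs @ [w])"
proof -
  note facts = berge_path_facts[OF path]
  have jv: "j \<le> length vs" using facts(1) j by simp
  have es: "set (take (Suc j) es) \<subseteq> edges H" using facts(4) set_take_subset by fast
  have es0: "es ! 0 \<in> edges H" using facts(4) j by (metis gr_zeroI less_nat_zero_code nth_mem subsetD)
  have nth: "(take j vs @ [w]) ! i \<in> ends H ((take (Suc j) es @ [es ! 0]) ! i) \<inter>
     ends H ((take (Suc j) es @ [es ! 0]) ! (i + 1))" if "i < Suc j" for i
  proof (cases "i = j")
    case True
    then show ?thesis using w j jv by (simp add: nth_append)
  next
    case False
    then show ?thesis using that facts(5)[of i] j jv by (simp add: nth_append)
  qed
  have "v \<in> verts H" if "v \<in> set (take j vs @ [w])" for v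
  proof -
    from that obtain i where "i < Suc j" "(take j vs @ [w]) ! i = v"
      using jv by (metis in_set_conv_nth length_append_singleton length_take min.absorb2)
    with nth[of i] have "v \<in> ends H (es ! i)" using j by (simp add: nth_append)
    moreover have "es ! i \<in> edges H" using \<open>i < Suc j\<close> j facts(4) by auto
    ultimately show ?thesis using ends_subset by blast
  qed
  then show ?thesis
    using j jv es es0 w nth facts(2,3)
    unfolding berge_cycle_def by (auto simp: nth_append)
qed

section \<open>Shared vertices and ears\<close>

definition shared :: "'e \<Rightarrow> 'v set" where
  "shared e = {u \<in> ends H e. \<exists>g\<in>edges H. g \<noteq> e \<and> u \<in> ends H g}"

lemma shared_subset: "shared e \<subseteq> ends H e"
  by (auto simp: shared_def)

text \<open>
  In terms of the expanded hypergraph: the intersection of \<open>e\<close> with every other hyperedge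
  is contained in \<open>f\<close>.
\<close>

definition ear :: "('v \<Rightarrow> 'e \<Rightarrow> nat) \<Rightarrow> 'e \<Rightarrow> 'e \<Rightarrow> bool" where
  "ear r e f \<longleftrightarrow> e \<in> edges H \<and> f \<in> edges H \<and> e \<noteq> f \<and>
    (\<forall>g\<in>edges H - {e}. \<forall>u\<in>ends H e \<inter> ends H g. u \<in> ends H f \<and> min (r u e) (r u g) \<le> r u f)"

text \<open>A copy of \<open>u\<close> common to \<open>e\<close> and \<open>g\<close> has index at
  most both ranks, so it lies in \<open>f\<close> once \<open>f\<close> ranks at least as high as
  \<open>e\<close>, or as all hyperedges other than \<open>e\<close>.\<close>

lemma earI:
  assumes "e \<in> edges H" "f \<in> edges H" "e \<noteq> f" "shared e \<subseteq> ends H f"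
    and "\<And>u. u \<in> shared e \<Longrightarrow> r u e \<le> r u f \<or> (\<forall>g\<in>edges_at H u - {e}. r u g \<le> r u f)"
  shows "ear r e f"
proof -
  have "u \<in> ends H f \<and> min (r u e) (r u g) \<le> r u f"
    if "g \<in> edges H - {e}" "u \<in> ends H e \<inter> ends H g" for g u
  proof -
    have "u \<in> shared e" using that by (auto simp: shared_def)
    moreover have "g \<in> edges_at H u - {e}" using that by (auto simp: edges_at_def)
    ultimately show ?thesis using assms(4) assms(5)[of u] by (auto simp: min_le_iff_disj)
  qed
  then show ?thesis using assms by (auto simp: ear_def)
qed

lemma finite_edges_at: "finite (edges_at H u)"
  using finite_edges by (simp add: edges_at_def)

text \<open>If \<open>v\<close> is shared, \<open>f\<close> is the highest ranked of the other
  hyperedges at \<open>v\<close>; if nothing is shared, any other hyperedge serves, and the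
  cardinality supplies one.\<close>

lemma ear_if_shared_le_1:
  assumes "e \<in> edges H" "2 \<le> card (edges H)" "shared e \<subseteq> {v}"
  shows "\<exists>f. ear r e f"
proof (cases "shared e = {}")
  case True
  have "edges H \<noteq> {e}" using assms(2) by auto
  then obtain f where "f \<in> edges H" "f \<noteq> e" using assms(1) by blast
  then show ?thesis using True assms by (intro exI[of _ f] earI) auto
next
  case False
  then have v: "shared e = {v}" using assms by auto
  then have "edges_at H v - {e} \<noteq> {}" by (auto simp: shared_def edges_at_def)
  with finite_edges_at obtain f
    where f: "f \<in> edges_at H v - {e}" "\<forall>g\<in>edges_at H v - {e}. r v g \<le> r v f"
    by (metis finite_Diff finite_has_max_image)
  then show ?thesis using v assms by (intro exI[of _ f] earI) (auto simp: edges_at_def)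
qed

end

section \<open>Longest Berge paths when no Berge cycle is longer than two\<close>

locale no_long_berge_cycle = hypergraph H for H :: "('v, 'e) hypergraph" +
  assumes no_cycle: "berge_cycle H n es vs \<Longrightarrow> n \<le> 2"
begin

lemma berge_path_chord:
  assumes "berge_path H es vs" "j < length es"
    and "w \<in> ends H (es ! 0)" "w \<in> ends H (es ! j)" "w \<notin> set (take j vs)"
  shows "j \<le> 1"
  using berge_path_closing[OF assms(1) _ assms(2-5)] no_cycle by force

definition max_path :: "'e list \<Rightarrow> 'v list \<Rightarrow> bool" where
  "max_path es vs \<longleftrightarrow> berge_path H es vs \<and>
    (\<forall>es' vs'. berge_path H es' vs' \<longrightarrow> length es' \<le> length es)"

lemma max_path_cong_length:
  "\<lbrakk>max_path es vs; berge_path H es' vs'; length es' = length es\<rbrakk> \<Longrightarrow> max_path es' vs'"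
  by (simp add: max_path_def)

lemma ex_max_path:
  assumes "edges H \<noteq> {}"
  obtains es vs where "max_path es vs"
proof -
  from assms obtain e where "e \<in> edges H" by blast
  then have "berge_path H [e] []" by simp
  then have ex: "\<exists>vs. berge_path H [e] vs" by blast
  have bound: "length es \<le> card (edges H)" if "\<exists>vs. berge_path H es vs" for es
    using that berge_path_facts(2,4) finite_edges by (metis card_mono distinct_card)
  have "\<exists>es. (\<exists>vs. berge_path H es vs) \<and>
      (\<forall>es'. (\<exists>vs. berge_path H es' vs) \<longrightarrow> length es' \<le> length es)"
    using bound
    by (intro ex_has_greatest_nat[where k = "[e]" and b = "Suc (card (edges H))"] ex)
      (simp add: less_Suc_eq_le)
  then show thesis using that by (auto simp: max_path_def)
qed

text \<open>A further hyperedge at \<open>w\<close> off the path could be put in front of it,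
  against maximality; one on the path at index 2 or beyond would make \<open>w\<close> a
  chord.\<close>

lemma off_path_edges_at:
  assumes "max_path (e # f # es) vs" "w \<in> shared e" "w \<notin> set vs"
  shows "edges_at H w = {e, f}"
proof -
  have path: "berge_path H (e # f # es) vs" using assms by (simp add: max_path_def)
  have "g = f" if "g \<in> edges H" "w \<in> ends H g" "g \<noteq> e" for g
  proof -
    have "g \<in> set (e # f # es)"
    proof (rule ccontr)
      assume "g \<notin> set (e # f # es)"
      then have "berge_path H (g # e # f # es) (w # vs)"
        using path assms that by (simp add: shared_def)
      then have "length (g # e # f # es) \<le> length (e # f # es)"
        using assms(1) unfolding max_path_def by blast
      then show False by simp
    qed
    then obtain j where j: "j < length (e # f # es)" "(e # f # es) ! j = g"
      by (auto simp only: in_set_conv_nth)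
    have "j \<le> 1"
      by (rule berge_path_chord[OF path j(1)])
        (use assms that j in \<open>auto simp: shared_def dest: in_set_takeD\<close>)
    then show ?thesis using j that by (cases j) auto
  qed

  moreover have "e \<in> edges H" "w \<in> ends H e"
    using berge_path_facts(4)[OF path] assms by (auto simp: shared_def)
  ultimately show ?thesis using assms(2) by (auto simp: edges_at_def shared_def)
qed

lemma on_path_vertex:
  assumes path: "berge_path H (e # f # es) (v # vs)" and u: "u \<in> ends H e" "u \<in> set vs"
  obtains vs' where "vs = u # vs'"
proof -
  note facts = berge_path_facts[OF path]
  obtain i where i: "i < length vs" "vs ! i = u" using u by (auto simp: in_set_conv_nth)
  \<comment> \<open>\<open>u\<close> has index \<open>Suc i\<close> in \<open>v # vs\<close>, so it
    lies in the hyperedge of that index and acts as a chord.\<close>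
  have "u \<notin> set (take (Suc i) (v # vs))"
    using i facts(3) by (auto simp: in_set_conv_nth nth_eq_iff_index_eq)
  then have "Suc i \<le> 1"
    using i u facts(1) facts(5)[of "Suc i"] by (intro berge_path_chord[OF path]) auto
  then show thesis using that i by (cases vs) auto
qed

text \<open>The case \<open>u = v\<close> holds because \<open>w\<close> can replace \<open>v\<close> on the path, which puts \<open>v\<close> off the path.\<close>

lemma off_path_edges_at_tip:
  assumes "max_path (e # f # es) (v # vs)" "w \<in> shared e" "w \<notin> set (v # vs)"
    and "u \<in> shared e" "u \<notin> set vs"
  shows "edges_at H u = {e, f}"
proof (cases "u = v")
  case True
  have "edges_at H w = {e, f}" using off_path_edges_at assms(1-3) .
  then have "max_path (e # f # es) (w # vs)"
    using assms(1,3) by (auto simp: max_path_def edges_at_def)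
  then show ?thesis using True assms by (intro off_path_edges_at[of e f es "w # vs"]) auto
next
  case False
  then show ?thesis using assms by (intro off_path_edges_at[of e f es "v # vs"]) auto
qed

lemma ear_if_off_path:
  assumes max: "max_path (e # f # es) (v # vs)" and w: "w \<in> shared e" "w \<notin> set (v # vs)"
  shows "\<exists>e f. ear r e f"
proof -
  have path: "berge_path H (e # f # es) (v # vs)" using max by (simp add: max_path_def)
  then have ef: "e \<in> edges H" "f \<in> edges H" "e \<noteq> f" "v \<in> ends H e" "v \<in> ends H f"
    using berge_path_facts(4)[OF path] by auto
  note at_e = off_path_edges_at_tip[OF max w]
  show ?thesis
  proof (cases "shared e \<inter> set vs = {}")
    case True
    then have "edges_at H u = {e, f}" if "u \<in> shared e" for u using at_e that by blast
    \<comment> \<open>At each shared vertex \<open>f\<close> is the only other hyperedge, hence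
      trivially the highest ranked one.\<close>
    then have "ear r e f" using ef by (intro earI) (auto simp: edges_at_def)
    then show ?thesis by blast
  next
    case False
    then obtain u where u: "u \<in> shared e" "u \<in> set vs" by blast
    then have "u \<in> ends H e" by (simp add: shared_def)
    with path u obtain vs' where vs: "vs = u # vs'" using on_path_vertex by blast
    have on: "x = u" if "x \<in> ends H e" "x \<in> set vs" for x
      using on_path_vertex[OF path that] vs by blast
    obtain g es' where es: "es = g # es'" using path vs by (cases es) auto
    have "edges_at H w = {e, f}" using at_e w by simp
    then have "w \<in> ends H f" "w \<in> ends H e" by (auto simp: edges_at_def)
    \<comment> \<open>Swapping \<open>e\<close> and \<open>f\<close> gives another longest path, so \<open>f\<close> obeys the same constraints as \<open>e\<close>.\<close>
    then have path': "berge_path H (f # e # es) (w # vs)"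
      using path w es vs \<open>u \<in> ends H e\<close> by auto
    then have max': "max_path (f # e # es) (w # vs)" using max by (auto intro: max_path_cong_length)
    have "v \<in> shared f" "v \<notin> set (w # vs)"
      using ef path w by (auto simp: shared_def)
    note at_f = off_path_edges_at_tip[OF max' this]
    have "u \<in> ends H f" using path es vs by simp
    have on': "x = u" if "x \<in> ends H f" "x \<in> set vs" for x
      using on_path_vertex[OF path' that] vs by blast
    have "x \<in> ends H f" if "x \<in> shared e" for x
      using at_e[OF that] on[of x] that \<open>u \<in> ends H f\<close> by (auto simp: shared_def edges_at_def)
    moreover have "x \<in> ends H e" if "x \<in> shared f" for x
      using at_f[OF that] on'[of x] that \<open>u \<in> ends H e\<close> by (auto simp: shared_def edges_at_def)
    moreover have "edges_at H x = {e, f} \<or> x = u" if "x \<in> shared e" for x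
      using at_e[OF that] on[of x] that by (auto simp: shared_def)
    moreover have "edges_at H x = {e, f} \<or> x = u" if "x \<in> shared f" for x
      using at_f[OF that] on'[of x] that by (auto simp: shared_def)
    \<comment> \<open>Apart from \<open>u\<close>, the shared vertices of \<open>e\<close> and
      \<open>f\<close> lie in these two only, so the ranks at \<open>u\<close> alone decide.\<close>
    ultimately have "ear r e f \<or> ear r f e"
      using ef by (cases "r u e \<le> r u f") (fastforce intro!: earI)+
    then show ?thesis by blast
  qed
qed

text \<open>There is an ear if \<open>shared e\<close> is within \<open>{v}\<close>, and also if it
  leaves the path. So \<open>e\<close> shares a vertex other than \<open>v\<close> on the path, and
  by the chord argument any such vertex is the second one.\<close>

lemma tip_shared:
  assumes no_ear: "\<nexists>e f. ear r e f" and "2 \<le> card (edges H)"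
    and max: "max_path (e # f # es) (v # vs)"
  obtains u vs' where "vs = u # vs'" "shared e = {v, u}"
proof -
  have path: "berge_path H (e # f # es) (v # vs)" using max by (simp add: max_path_def)
  then have "e \<in> edges H" by simp
  then have "\<not> shared e \<subseteq> {v}" using ear_if_shared_le_1 assms by blast
  then obtain u where u: "u \<in> shared e" "u \<noteq> v" by blast
  have sub: "shared e \<subseteq> set (v # vs)" using ear_if_off_path[OF max] no_ear by blast
  obtain vs' where vs: "vs = u # vs'"
    using on_path_vertex[OF path, of u] u sub by (auto simp: shared_def)
  have "x = u" if "x \<in> shared e" "x \<noteq> v" for x
    using on_path_vertex[OF path, of x] that sub vs by (auto simp: shared_def)
  moreover have "v \<in> shared e"
    using path berge_path_facts(4)[OF path] by (auto simp: shared_def)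
  ultimately show thesis using that vs u by blast
qed

text \<open>Each such \<open>h\<close> starts a longest path continuing with \<open>v\<close> and
  \<open>u\<close>, to which \<open>tip_shared\<close> applies: \<open>f\<close> after interchanging
  \<open>e\<close> and \<open>f\<close>, a third \<open>h\<close> in the path
  \<open>h, v, e, u, g\<close>, where \<open>f\<close> is dropped.\<close>

lemma tip_vertex_shared:
  assumes no_ear: "\<nexists>e f. ear r e f" and card: "2 \<le> card (edges H)"
    and max: "max_path (e # f # g # es) (v # u # vs)"
    and h: "h \<in> edges_at H v" "h \<noteq> g"
  shows "shared h = {v, u}"
proof -
  have path: "berge_path H (e # f # g # es) (v # u # vs)" using max by (simp add: max_path_def)
  note shared = tip_shared[OF no_ear card]
  have e: "shared e = {v, u}" by (rule shared[OF max]) auto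
  then have ue: "u \<in> ends H e" using shared_subset by blast
  with path have "berge_path H (f # e # g # es) (v # u # vs)" by auto
  then have max': "max_path (f # e # g # es) (v # u # vs)"
    using max by (auto intro: max_path_cong_length)
  have f: "shared f = {v, u}" by (rule shared[OF max']) auto
  have hv: "h \<in> edges H" "v \<in> ends H h" using h by (auto simp: edges_at_def)
  have "shared h = {v, u}" if "h \<noteq> e" "h \<noteq> f"
  proof -
    have "berge_path H (e # g # es) (u # vs)" using path ue by simp
    moreover have "h \<notin> set es"
    proof
      assume "h \<in> set es"
      then obtain j where j: "j < length es" "es ! j = h" by (auto simp: in_set_conv_nth)
      \<comment> \<open>\<open>h\<close> has index \<open>Suc (Suc j)\<close> on the path starting
        with \<open>e, u, g\<close>, where \<open>v\<close> no longer occurs and so is a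
        chord.\<close>
      have "Suc (Suc j) \<le> 1"
        by (rule berge_path_chord[OF \<open>berge_path H (e # g # es) (u # vs)\<close>, where w = v])
          (use path j hv in \<open>auto dest: in_set_takeD\<close>)
      then show False by simp
    qed
    ultimately have "berge_path H (h # e # g # es) (v # u # vs)"
      using path hv h that by auto
    then have "max_path (h # e # g # es) (v # u # vs)"
      using max by (auto intro: max_path_cong_length)
    then show ?thesis by (rule shared) auto
  qed
  with e f show ?thesis by blast
qed

text \<open>
  Candidates are an \<open>a\<close>-minimal \<open>e\<close> with a \<open>b\<close>-maximal \<open>f\<close>, and vice versa. The first pair fails only if
  \<open>z\<close> is \<open>b\<close>-maximal outside \<open>e\<close> and strictly \<open>a\<close>-minimal; then the second pair works.
\<close>

lemma finite_two_rankings: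
  fixes a b :: "'a \<Rightarrow> nat"
  assumes "finite X" "x \<in> X - {z}" "y \<in> X - {z}" "x \<noteq> y"
  obtains e f where "e \<in> X - {z}" "f \<in> X - {e}"
    "a e \<le> a f \<or> (\<forall>g\<in>X - {e}. a g \<le> a f)" "b e \<le> b f \<or> (\<forall>g\<in>X - {e}. b g \<le> b f)"
proof -
  have fin: "finite (X - {w})" for w using assms by blast
  have ne: "X - {w} \<noteq> {}" for w using assms by blast
  obtain e where e: "e \<in> X - {z}" "\<forall>g\<in>X - {z}. a e \<le> a g"
    using finite_has_min_image[OF fin ne] by blast
  obtain f where f: "f \<in> X - {e}" "\<forall>g\<in>X - {e}. b g \<le> b f"
    using finite_has_max_image[OF fin ne] by blast
  obtain e' where e': "e' \<in> X - {z}" "\<forall>g\<in>X - {z}. b e' \<le> b g"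
    using finite_has_min_image[OF fin ne] by blast
  obtain f' where f': "f' \<in> X - {e'}" "\<forall>g\<in>X - {e'}. a g \<le> a f'"
    using finite_has_max_image[OF fin ne] by blast
  show thesis
  proof (cases "f = z \<and> a z < a e")
    case False
    then have "a e \<le> a f" using e f by auto
    with that e f show thesis by blast
  next
    case True
    have "f' \<noteq> z"
    proof
      assume "f' = z"
      \<comment> \<open>As \<open>x\<close> and \<open>y\<close> differ, there is an element outside
        \<open>z\<close> besides \<open>e'\<close>.\<close>
      obtain g where "g \<in> X - {z}" "g \<noteq> e'" using assms by metis
      then have "a e \<le> a g" "a g \<le> a z" using e f' \<open>f' = z\<close> by auto
      with True show False by simp
    qed
    then have "b e' \<le> b f'" using e' f' by auto
    with that e' f' show thesis by blast
  qed
qed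

lemma ex_ear:
  assumes card: "2 \<le> card (edges H)"
  shows "\<exists>e f. ear r e f"
proof (rule ccontr)
  assume no_ear: "\<not> ?thesis"
  have "edges H \<noteq> {}" using card by auto
  then obtain es vs where max: "max_path es vs" using ex_max_path by blast
  then have path: "berge_path H es vs" by (simp add: max_path_def)
  obtain e es1 where es: "es = e # es1" using path by (cases es) auto
  obtain f es2 v vs2 where es1: "es1 = f # es2" "vs = v # vs2"
  proof (cases es1)
    case Nil
    then have "e \<in> edges H" using path es by (cases vs) auto
    \<comment> \<open>Any singleton would do here: the point is that \<open>shared e\<close> is
      nonempty, so a path with two hyperedges exists.\<close>
    then have "\<not> shared e \<subseteq> {undefined}" using ear_if_shared_le_1 card no_ear by blast
    then obtain g u where "g \<in> edges H" "g \<noteq> e" "u \<in> ends H e" "u \<in> ends H g"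
      by (auto simp: shared_def)
    then have "berge_path H [g, e] [u]" using \<open>e \<in> edges H\<close> by simp
    then have "length [g, e] \<le> length es" using max unfolding max_path_def by blast
    then show thesis using es Nil by simp
  next
    case (Cons f es2)
    then show thesis using that path es by (cases vs) auto
  qed
  have max: "max_path (e # f # es2) (v # vs2)" using max es es1 by simp
  obtain u vs3 where vs2: "vs2 = u # vs3" and e: "shared e = {v, u}"
    using tip_shared[OF no_ear card max] .
  obtain g es3 where es2: "es2 = g # es3" using path es es1 vs2 by (cases es2) auto
  have max: "max_path (e # f # g # es3) (v # u # vs3)" using max es2 vs2 by simp
  then have path: "berge_path H (e # f # g # es3) (v # u # vs3)" by (simp add: max_path_def)
  have edges: "e \<in> edges H" "f \<in> edges H" "g \<in> edges H" "e \<noteq> f" "e \<noteq> g" "f \<noteq> g" "u \<noteq> v"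
    using path berge_path_facts(4)[OF path] by auto
  have ue: "u \<in> ends H e" using e shared_subset by blast
  note sh_v = tip_vertex_shared[OF no_ear card max]
  have ends_v: "{v, u} \<subseteq> ends H h" if "h \<in> edges_at H v" "h \<noteq> g" for h
    using sh_v[OF that] shared_subset[of h] by simp
  have ef: "e \<in> edges_at H v - {g}" "f \<in> edges_at H v - {g}"
    using path edges by (auto simp: edges_at_def)
  have sub_v: "edges_at H v \<subseteq> edges H" by (auto simp: edges_at_def)
  show False
  proof (cases "v \<in> ends H g")
    \<comment> \<open>All hyperedges at \<open>v\<close> now share exactly \<open>v\<close> and
      \<open>u\<close>. One of least rank at \<open>u\<close> is the ear, with \<open>f'\<close> the
      highest ranked of the others at \<open>v\<close>.\<close>
    case False
    then have g: "g \<notin> edges_at H v" by (simp add: edges_at_def)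
    have ne: "edges_at H v \<noteq> {}" using ef by blast
    obtain e' where e': "e' \<in> edges_at H v" "\<forall>h\<in>edges_at H v. r u e' \<le> r u h"
      using finite_has_min_image[OF finite_edges_at ne] by blast
    have fin: "finite (edges_at H v - {e'})" using finite_edges_at by blast
    have "edges_at H v - {e'} \<noteq> {}" using ef \<open>e \<noteq> f\<close> by blast
    then obtain f' where f': "f' \<in> edges_at H v - {e'}" "\<forall>h\<in>edges_at H v - {e'}. r v h \<le> r v f'"
      using finite_has_max_image[OF fin] by blast
    have "e' \<noteq> g" "f' \<noteq> g" using e' f' g by blast+
    then have "shared e' = {v, u}" "{v, u} \<subseteq> ends H f'" using sh_v ends_v e' f' by blast+
    then have "ear r e' f'" using e' f' sub_v by (intro earI) auto
    then show False using no_ear by blast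
  next
    case True
    \<comment> \<open>\<open>f\<close> contains both \<open>v\<close> and \<open>u\<close>, so with
      \<open>u\<close> in \<open>e\<close> and \<open>v\<close> in \<open>g\<close> the two can be
      interchanged. The facts about \<open>v\<close> then hold for \<open>u\<close> too, and the
      same hyperedges meet at both.\<close>
    have "berge_path H (e # f # g # es3) (u # v # vs3)"
      using path True ue by auto
    then have "max_path (e # f # g # es3) (u # v # vs3)"
      using max by (auto intro: max_path_cong_length)
    note sh_u = tip_vertex_shared[OF no_ear card this]
    have ends_u: "{v, u} \<subseteq> ends H h" if "h \<in> edges_at H u" "h \<noteq> g" for h
      using sh_u[OF that] shared_subset[of h] by simp
    have "u \<in> ends H g" using path by simp
    have eq: "edges_at H u = edges_at H v"
    proof (intro set_eqI)
      fix h
      show "h \<in> edges_at H u \<longleftrightarrow> h \<in> edges_at H v"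
        using ends_u[of h] ends_v[of h] True \<open>u \<in> ends H g\<close>
        by (cases "h = g") (auto simp: edges_at_def)
    qed
    \<comment> \<open>\<open>g\<close> may share further vertices, so it is barred from being the
      ear \<open>e'\<close>; it contains \<open>v\<close> and \<open>u\<close>, so it may be
      \<open>f'\<close>.\<close>
    obtain e' f' where ef': "e' \<in> edges_at H v - {g}" "f' \<in> edges_at H v - {e'}"
      and "r u e' \<le> r u f' \<or> (\<forall>h\<in>edges_at H v - {e'}. r u h \<le> r u f')"
        "r v e' \<le> r v f' \<or> (\<forall>h\<in>edges_at H v - {e'}. r v h \<le> r v f')"
      by (rule finite_two_rankings[OF finite_edges_at ef \<open>e \<noteq> f\<close>, of "r u" "r v"])
    moreover have "{v, u} \<subseteq> ends H f'"
      using ef' eq by (auto simp: edges_at_def)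
    moreover have "shared e' = {v, u}" using sh_v ef' by blast
    ultimately have "ear r e' f'"
      using eq sub_v by (intro earI) auto
    then show False using no_ear by blast
  qed
qed

end

section \<open>Join trees by removing ears\<close>

lemma ranked_join_tree:
  fixes r :: "'v \<Rightarrow> 'e \<Rightarrow> nat"
  assumes "no_long_berge_cycle H"
  shows "\<exists>T. is_tree (edges H) T \<and>
    (\<forall>x. connected_in T {e \<in> edges H. x \<in> (SIGMA u:ends H e. {1..r u e})})"
  using assms
proof (induction "card (edges H)" arbitrary: H rule: less_induct)
  case less
  interpret no_long_berge_cycle H by fact
  show ?case
  proof (cases "2 \<le> card (edges H)")
    case False
    then have single: "e = f" if "e \<in> edges H" "f \<in> edges H" for e f
      using that finite_edges card_le_Suc0_iff_eq[of "edges H"] by (simp add: not_le less_Suc_eq_le numeral_2_eq_2)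
    have "is_tree (edges H) {}"
      using single finite_edges
      by (auto simp: is_tree_def connected_in_def graph_cycle_def intro: exI[of _ 0])
    moreover have "connected_in {} {e \<in> edges H. x \<in> (SIGMA u:ends H e. {1..r u e})}" for x
      using single by (auto simp: connected_in_def)
    ultimately show ?thesis by blast
  next
    case True
    then obtain e f where ear: "ear r e f" using ex_ear by blast
    then have ef: "e \<in> edges H" "f \<in> edges H" "e \<noteq> f" by (auto simp: ear_def)
    \<comment> \<open>Ranks need not be positions, so the same \<open>r\<close> serves after
      \<open>e\<close> is removed.\<close>
    define H' where "H' = H\<lparr>edges := edges H - {e}\<rparr>"
    have H': "edges H' = edges H - {e}" "ends H' = ends H" "verts H' = verts H"
      by (simp_all add: H'_def)
    have "no_long_berge_cycle H'"
    proof
      fix n es vs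
      assume "berge_cycle H' n es vs"
      then have "berge_cycle H n es vs" by (auto simp: berge_cycle_def H')
      then show "n \<le> 2" by (rule no_cycle)
    qed (use finite_verts finite_edges ends_nonempty ends_subset in \<open>auto simp: H'\<close>)
    moreover have "card (edges H') < card (edges H)"
      using ef finite_edges by (simp only: H' card_Diff1_less)
    ultimately obtain T where T: "is_tree (edges H - {e}) T"
      and conn: "\<And>x. connected_in T {g \<in> edges H - {e}. x \<in> (SIGMA u:ends H g. {1..r u g})}"
      using less.hyps[of H'] by (auto simp only: H')
    have "connected_in (insert {e, f} T) {g \<in> edges H. x \<in> (SIGMA u:ends H g. {1..r u g})}"
      (is "connected_in _ ?S") for x
    proof (cases "e \<in> ?S")
      case True
      have "?S - {e} = {g \<in> edges H - {e}. x \<in> (SIGMA u:ends H g. {1..r u g})}" by blast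
      then have "connected_in T (?S - {e})" using conn by simp
      moreover have "f \<in> ?S - {e}" if ne: "?S - {e} \<noteq> {}"
      proof -
        obtain u i where x: "x = (u, i)" by force
        from ne obtain g where "g \<in> edges H - {e}" "u \<in> ends H g" "i \<le> r u g" by (auto simp: x)
        moreover have "u \<in> ends H e" "i \<le> r u e" "1 \<le> i" using True by (auto simp: x)
        \<comment> \<open>The copy \<open>(u, i)\<close> lies in \<open>e\<close> and
          \<open>g\<close>, so \<open>i\<close> is at most both ranks, and the ear property puts the
          copy into \<open>f\<close>.\<close>
        ultimately have "u \<in> ends H f \<and> min (r u e) (r u g) \<le> r u f" "i \<le> min (r u e) (r u g)"
          using ear unfolding ear_def by auto
        then have "u \<in> ends H f" "i \<le> r u f" by auto
        then show ?thesis using \<open>1 \<le> i\<close> ef by (auto simp: x)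
      qed
      ultimately show ?thesis by (rule connected_in_insert_leaf)
    next
      case False
      then have "?S = {g \<in> edges H - {e}. x \<in> (SIGMA u:ends H g. {1..r u g})}" by blast
      then have "connected_in T ?S" using conn by simp
      then show ?thesis by (rule connected_in_mono) blast
    qed
    moreover have "is_tree (edges H) (insert {e, f} T)" using T ef by (rule is_tree_insert_leaf)
    ultimately show ?thesis by blast
  qed
qed

lemma iota_acyclic_if_no_long_berge_cycle:
  assumes "no_long_berge_cycle H"
  shows "iota_acyclic H"
  unfolding iota_acyclic_def tau_def
proof clarify
  fix \<sigma>
  have ends: "ends (expand H \<sigma>) e = (SIGMA u:ends H e. {1..edge_position H \<sigma> u e})" for e
    by (auto simp: expand_def)
  obtain T where "is_tree (edges H) T"
    "\<forall>x. connected_in T {e \<in> edges H. x \<in> (SIGMA u:ends H e. {1..edge_position H \<sigma> u e})}"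
    using ranked_join_tree[OF assms] by blast
  then have "join_tree (expand H \<sigma>) (edges H) T id"
    unfolding join_tree_def ends by (simp add: expand_def del: mem_Sigma_iff)
  then show "alpha_acyclic (expand H \<sigma>)" unfolding alpha_acyclic_def by blast
qed

section \<open>A long Berge cycle yields an expansion without join tree\<close>

lemma ordering_with_last_two:
  assumes "finite X" "a \<in> X" "b \<in> X" "a \<noteq> b"
  shows "\<exists>p. bij_betw p {1..card X} X \<and>
    {e \<in> X. card X - 1 \<le> inv_into {1..card X} p e} = {a, b}"
proof -
  let ?n = "card X"
  define m where "m = card (X - {a, b})"
  have "finite (X - {a, b})" using assms by simp
  then obtain q where q: "bij_betw q {1..m} (X - {a, b})"
    unfolding m_def using ex_bij_betw_nat_finite_1 by blast
  have n: "?n = m + 2"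
  proof -
    have "card {a, b} \<le> card X" using assms by (intro card_mono) auto
    then show ?thesis using assms by (simp add: m_def card_Diff_subset)
  qed
  \<comment> \<open>\<open>a\<close> and \<open>b\<close> take the last two positions, so copy
    number \<open>card X - 1\<close> of the vertex will lie in these two hyperedges only.\<close>
  define p where "p i = (if i \<le> m then q i else if i = Suc m then a else b)" for i
  have p_last: "p (Suc m) = a" "p (m + 2) = b" by (simp_all add: p_def)
  have "bij_betw p {1..m} (X - {a, b})"
    by (rule bij_betw_cong[THEN iffD1, OF _ q]) (simp add: p_def)
  moreover have "bij_betw p {Suc m, m + 2} {a, b}"
    using assms(4) p_last by (simp add: bij_betw_def)
  ultimately have "bij_betw p ({1..m} \<union> {Suc m, m + 2}) ((X - {a, b}) \<union> {a, b})"
    by (rule bij_betw_combine) blast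
  moreover have "{1..m} \<union> {Suc m, m + 2} = {1..?n}" unfolding n by auto
  moreover have "(X - {a, b}) \<union> {a, b} = X" using assms by blast
  ultimately have p: "bij_betw p {1..?n} X" by simp
  have "?n - 1 \<le> inv_into {1..?n} p e \<longleftrightarrow> e = a \<or> e = b" if e: "e \<in> X" for e
  proof -
    obtain i where i: "i \<in> {1..?n}" "e = p i" using e p by (metis bij_betw_imp_surj_on imageE)
    have "Suc m \<in> {1..?n}" "m + 2 \<in> {1..?n}" unfolding n by simp_all
    then have "e = a \<longleftrightarrow> i = Suc m" "e = b \<longleftrightarrow> i = m + 2"
      using i p_last inj_on_eq_iff[OF bij_betw_imp_inj_on[OF p]] by metis+
    moreover have "inv_into {1..?n} p e = i"
      unfolding i(2) using p i(1) by (rule bij_betw_inv_into_left)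
    ultimately show ?thesis using i(1) unfolding n by auto
  qed
  then have "{e \<in> X. ?n - 1 \<le> inv_into {1..?n} p e} = {a, b}" using assms(2,3) by blast
  with p show ?thesis by blast
qed

lemma connected_in_pair:
  assumes "connected_in T {s, t}" "s \<noteq> t"
  shows "{s, t} \<in> T"
proof -
  have "(s, t) \<in> {(x, y). x \<in> {s, t} \<and> y \<in> {s, t} \<and> {x, y} \<in> T}\<^sup>*"
    using assms unfolding connected_in_def by blast

  then have "t = s \<or> {s, t} \<in> T"
  proof (induction rule: rtrancl_induct)
    case (step y z)
    then show ?case by (auto simp: insert_commute)
  qed simp
  then show ?thesis using assms by blast
qed

lemma long_berge_cycle_not_iota_acyclic:
  assumes "hypergraph H" and cyc: "berge_cycle H n es vs" and n: "n > 2"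
  shows "\<not> iota_acyclic H"
proof -
  interpret hypergraph H by fact
  have len: "length es = n + 1" "length vs = n" and sub: "set es \<subseteq> edges H" "set vs \<subseteq> verts H"
    and dist: "distinct vs" "distinct (take n es)" and closed: "es ! n = es ! 0"
    and inc: "\<And>i. i < n \<Longrightarrow> vs ! i \<in> ends H (es ! i) \<inter> ends H (es ! (i + 1))"
    using cyc by (auto simp: berge_cycle_def)
  \<comment> \<open>The closing entry at index \<open>n\<close> repeats index 0, so successors can
    be read modulo \<open>n\<close>.\<close>
  have succ: "es ! (i + 1) = es ! (Suc i mod n)" if "i < n" for i
    using that closed by (cases "Suc i = n") auto
  have neq: "es ! i \<noteq> es ! j" if "i < n" "j < n" "i \<noteq> j" for i j
    using dist(2) that len nth_eq_iff_index_eq[of "take n es" i j] by simp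
  have succ_neq: "i \<noteq> Suc i mod n" "Suc i mod n < n" if "i < n" for i
    using that n by (cases "Suc i = n"; simp)+
  have E: "es ! i \<in> edges H" if "i \<le> n" for i using that len sub by auto
  \<comment> \<open>As \<open>vs\<close> is distinct, at most one pair is required to come last at
    \<open>u\<close>; vertices off the cycle take any ordering.\<close>
  have "\<exists>p. bij_betw p {1..card (edges_at H u)} (edges_at H u) \<and>
    (\<forall>i<n. vs ! i = u \<longrightarrow> {e \<in> edges_at H u. card (edges_at H u) - 1 \<le>
      inv_into {1..card (edges_at H u)} p e} = {es ! i, es ! (i + 1)})" (is "?ordered u") for u
  proof (cases "u \<in> set vs")
    case True
    then obtain i where i: "i < n" "vs ! i = u" using len by (auto simp: in_set_conv_nth)
    then have uniq: "j = i" if "j < n" "vs ! j = u" for j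
      using that i nth_eq_iff_index_eq[OF dist(1), of j i] len by simp
    have "es ! i \<noteq> es ! (i + 1)" using succ neq succ_neq i by simp
    moreover have "es ! i \<in> edges_at H u" "es ! (i + 1) \<in> edges_at H u"
      using inc[OF i(1)] i E by (auto simp: edges_at_def)
    ultimately have "\<exists>p. bij_betw p {1..card (edges_at H u)} (edges_at H u) \<and>
      {e \<in> edges_at H u. card (edges_at H u) - 1 \<le>
        inv_into {1..card (edges_at H u)} p e} = {es ! i, es ! (i + 1)}"
      by (intro ordering_with_last_two finite_edges_at)
    then show ?thesis using uniq by (elim ex_forward) simp
  next
    case False
    moreover have "\<exists>p. bij_betw p {1..card (edges_at H u)} (edges_at H u)"
      using ex_bij_betw_nat_finite_1[OF finite_edges_at] .
    moreover have "vs ! i \<noteq> u" if "i < n" for i using False len that by auto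
    ultimately show ?thesis by simp
  qed
  then have "\<forall>u. ?ordered u" by blast
  from choice[OF this] obtain \<sigma>
    where \<sigma>: "\<forall>u. bij_betw (\<sigma> u) {1..card (edges_at H u)} (edges_at H u) \<and>
      (\<forall>i<n. vs ! i = u \<longrightarrow> {e \<in> edges_at H u. card (edges_at H u) - 1 \<le>
        edge_position H \<sigma> u e} = {es ! i, es ! (i + 1)})"
    unfolding edge_position_def by blast
  then have bij: "bij_betw (\<sigma> u) {1..card (edges_at H u)} (edges_at H u)" for u by blast
  have last: "{e \<in> edges_at H (vs ! i). card (edges_at H (vs ! i)) - 1 \<le>
      edge_position H \<sigma> (vs ! i) e} = {es ! i, es ! (i + 1)}" if "i < n" for i
    using \<sigma> that by blast
  have "\<not> alpha_acyclic (expand H \<sigma>)"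
  proof
    assume "alpha_acyclic (expand H \<sigma>)"
    then obtain N :: "'b set" and T \<chi> where jt: "join_tree (expand H \<sigma>) N T \<chi>"
      by (auto simp: alpha_acyclic_def)
    then have \<chi>: "bij_betw \<chi> N (edges H)" by (simp add: join_tree_def expand_def)
    define t where "t i = inv_into N \<chi> (es ! i)" for i
    have t: "t i \<in> N" "\<chi> (t i) = es ! i" if "i < n" for i
    proof -
      have "es ! i \<in> \<chi> ` N" using E[of i] that \<chi> by (simp add: bij_betw_def)
      then show "t i \<in> N" "\<chi> (t i) = es ! i"
        unfolding t_def by (rule inv_into_into, rule f_inv_into_f)
    qed
    have t_iff: "\<chi> s = es ! i \<longleftrightarrow> s = t i" if "i < n" "s \<in> N" for i s
      using t[OF that(1)] that(2) inj_on_eq_iff[OF bij_betw_imp_inj_on[OF \<chi>], of s "t i"] by simp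
    have "{t i, t (Suc i mod n)} \<in> T" if i: "i < n" for i
    proof -
      let ?u = "vs ! i" and ?m = "card (edges_at H (vs ! i)) - 1"
      have "{es ! i, es ! (i + 1)} \<subseteq> edges_at H ?u"
        using inc[OF i] E i by (auto simp: edges_at_def)
      then have "card {es ! i, es ! (i + 1)} \<le> card (edges_at H ?u)"
        by (rule card_mono[OF finite_edges_at])
      \<comment> \<open>Two distinct hyperedges meet at \<open>?u\<close>, so the last but one copy
        has index at least 1 and exists.\<close>
      then have m: "1 \<le> ?m" using succ neq succ_neq i by simp
      have "?u \<in> verts H" using i len sub by auto
      then have "(?u, ?m) \<in> verts (expand H \<sigma>)" using m by (auto simp: expand_def)
      then have conn: "connected_in T {s \<in> N. (?u, ?m) \<in> ends (expand H \<sigma>) (\<chi> s)}"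
        using jt by (simp add: join_tree_def)
      \<comment> \<open>A hyperedge at \<open>?u\<close> contains copy \<open>?m\<close> iff its
        position is at least \<open>?m\<close>, that is, iff it is one of the last two.\<close>
      have "{s \<in> N. (?u, ?m) \<in> ends (expand H \<sigma>) (\<chi> s)} =
        {s \<in> N. \<chi> s \<in> {e \<in> edges_at H ?u. ?m \<le> edge_position H \<sigma> ?u e}}"
        using m bij_betw_apply[OF \<chi>] by (auto simp: expand_def edges_at_def)
      also have "\<dots> = {s \<in> N. \<chi> s = es ! i \<or> \<chi> s = es ! (Suc i mod n)}"
        unfolding last[OF i] succ[OF i] by simp
      also have "\<dots> = {t i, t (Suc i mod n)}"
        using t(1)[OF i] t(1)[OF succ_neq(2)[OF i]] t_iff[OF i] t_iff[OF succ_neq(2)[OF i]] by blast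
      finally have "connected_in T {t i, t (Suc i mod n)}" using conn by simp
      moreover have "t i \<noteq> t (Suc i mod n)"
        using t(2)[OF i] t(2)[OF succ_neq(2)[OF i]] neq[OF i succ_neq(2)[OF i] succ_neq(1)[OF i]] by auto
      ultimately show ?thesis by (rule connected_in_pair)
    qed
    moreover have "inj_on t {..<n}" using t(2) neq by (intro inj_onI) (metis lessThan_iff)
    \<comment> \<open>Consecutive nodes are adjacent, and \<open>n > 2\<close> supplies the three
      nodes that a cycle in \<open>T\<close> needs.\<close>
    ultimately have "graph_cycle T (map t [0..<n])"
      using n succ_neq by (simp add: graph_cycle_def distinct_map atLeast0LessThan)
    then show False using jt by (auto simp: join_tree_def is_tree_def)
  qed
  moreover have "\<sigma> \<in> edge_orderings H" using bij by (simp add: edge_orderings_def)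
  ultimately show ?thesis by (auto simp: iota_acyclic_def tau_def)
qed

theorem theorem6p3:
  fixes H :: "('v, 'e) hypergraph"
  assumes "hypergraph H"
  shows "iota_acyclic H \<longleftrightarrow> \<not> (\<exists>n es vs. n > 2 \<and> berge_cycle H n es vs)"
proof
  assume "iota_acyclic H"
  then show "\<not> (\<exists>n es vs. n > 2 \<and> berge_cycle H n es vs)"
    using long_berge_cycle_not_iota_acyclic assms by blast
next
  assume "\<not> (\<exists>n es vs. n > 2 \<and> berge_cycle H n es vs)"
  then have "no_long_berge_cycle H"
    using assms by (intro no_long_berge_cycle.intro no_long_berge_cycle_axioms.intro) (auto simp: not_less[symmetric])
  then show "iota_acyclic H" by (rule iota_acyclic_if_no_long_berge_cycle)
qed

end
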